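(* (1) For every (non-degenerate) tetrahedron $P\subset\mathbb{R}^3$ and every point $y\in \mathrm{Int}\,P$, one has $n(P,y)\ge 4$. (2) There exist a tetrahedron $P\subset\mathbb{R}^3$ and a point $y\in\mathrm{Int}\,P$ with $n(P,y)=4$.
   Context: For a compact convex polytope $P\subset\mathbb{R}^3$ with non-empty interior and $y\in \mathrm{Int}\,P$, a normal to $\partial P$ emanating from $y$ is a segment $yz$ such that there is a support plane $h$ of $P$ with $z\in h\cap P$ and $yz$ orthogonal to $h$; $z$ is the base of the normal. $n(P,y)$ is the number of normals to $\partial P$ emanating from $y$ (equivalently, the number of their bases). *)

theory Defs
  imports "HOL-Analysis.Analysis"
begin

definition support_plane :: "(real^3) set \<Rightarrow> (real^3) set \<Rightarrow> bool" where
  "support_plane P h \<longleftrightarrow>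
     (\<exists>a b. a \<noteq> 0 \<and> h = {x. a \<bullet> x = b} \<and> P \<subseteq> {x. a \<bullet> x \<le> b} \<and> h \<inter> P \<noteq> {})"

definition segment_orthogonal_to_plane :: "real^3 \<Rightarrow> real^3 \<Rightarrow> (real^3) set \<Rightarrow> bool" where
  "segment_orthogonal_to_plane y z h \<longleftrightarrow> (\<forall>u\<in>h. \<forall>v\<in>h. orthogonal (z - y) (u - v))"

text \<open>The degenerate segment \<open>z = y\<close> is not excluded explicitly: for \<open>y\<close> in the interior
  of \<open>P\<close> it cannot occur, since every \<open>z\<close> below lies on the boundary of \<open>P\<close>.\<close>

definition normal_base :: "(real^3) set \<Rightarrow> real^3 \<Rightarrow> real^3 \<Rightarrow> bool" where
  "normal_base P y z \<longleftrightarrow>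
     (\<exists>h. support_plane P h \<and> z \<in> h \<inter> P \<and> segment_orthogonal_to_plane y z h)"

definition normals :: "(real^3) set \<Rightarrow> real^3 \<Rightarrow> (real^3) set set" where
  "normals P y = {closed_segment y z | z. normal_base P y z}"

text \<open>For a polytope \<open>P\<close> and an interior point \<open>y\<close> there are only finitely many normals, as the
  relative interior of each face contains at most one base. So the convention that \<open>card\<close> is
  \<open>0\<close> on infinite sets is harmless; in any case \<open>4 \<le> num_normals P y\<close> and
  \<open>num_normals P y = 4\<close> both entail finiteness.\<close>

definition num_normals :: "(real^3) set \<Rightarrow> real^3 \<Rightarrow> nat" where
  "num_normals P y = card (normals P y)"

lemma num_normals_eq_card_bases: "num_normals P y = card {z. normal_base P y z}"
proof -
  have "inj_on (closed_segment y) {z. normal_base P y z}"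
    by (auto simp: inj_on_def closed_segment_eq doubleton_eq_iff)
  moreover have "normals P y = closed_segment y ` {z. normal_base P y z}"
    by (auto simp: normals_def)
  ultimately show ?thesis
    by (simp add: num_normals_def card_image)
qed

text \<open>A tetrahedron is the library's \<open>3 simplex P\<close>: the convex hull of four affinely
  independent points, hence automatically non-degenerate.\<close>

end

theory Submission imports Defs begin

text \<open>
  Put the interior point at the origin and let \<open>v\<^sub>1, \<dots>, v\<^sub>4\<close> be the vertices; \<open>z\<close> is a base iff
  \<open>z\<close> is a nonzero point of \<open>P\<close> with \<open>z \<bullet> v\<^sub>j \<le> z \<bullet> z\<close> for all \<open>j\<close>. Inversion \<open>z \<mapsto> z / |z|\<^sup>2\<close> turns
  the bases of \<open>P\<close> into the bases of the polar simplex, exchanging vertices and faces.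
  If at least two vertices are bases in the strict sense and at least two faces contain the foot
  of their perpendicular, these are four bases. Otherwise, up to polarity, every vertex but one
  has \<open>v\<^sub>i \<bullet> v\<^sub>j \<ge> v\<^sub>i \<bullet> v\<^sub>i\<close> for another vertex \<open>v\<^sub>j\<close>, necessarily farther from the origin. Hence the
  graph of pairs with \<open>v\<^sub>i \<bullet> v\<^sub>j > 0\<close> is connected; no vertex is adjacent to all others because the
  origin is interior, so the graph has a Hamiltonian path \<open>a, b, c, d\<close>. Projecting along the
  directions of the vertices, the positivity along this path forces enough other signs to show that
  the feet of the perpendiculars to the faces opposite \<open>b\<close> and \<open>c\<close> and to the edge \<open>ad\<close> are
  bases; the vertex farthest from the origin is a fourth one.
\<close>

section \<open>Critical points of a finite family of points\<close>

definition critical :: "('i \<Rightarrow> 'a::real_inner) \<Rightarrow> 'a set" where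
  "critical v = {z. z \<noteq> 0 \<and> z \<in> convex hull (range v) \<and> (\<forall>j. z \<bullet> v j \<le> z \<bullet> z)}"

lemma hull_range_explicit:
  fixes v :: "'i::finite \<Rightarrow> 'a::real_vector"
  assumes "z \<in> convex hull (range v)"
  obtains u where "\<And>i. u i \<ge> 0" "sum u UNIV = 1" "z = (\<Sum>i\<in>UNIV. u i *\<^sub>R v i)"
proof -
  have "convex hull (\<Union>i\<in>UNIV. {v i}) =
      {\<Sum>i\<in>UNIV. c i *\<^sub>R s i | c s. (\<forall>i\<in>UNIV. 0 \<le> c i) \<and> sum c UNIV = 1 \<and> (\<forall>i\<in>UNIV. s i \<in> {v i})}"
    by (rule convex_hull_finite_union) auto
  moreover have "(\<Union>i\<in>UNIV. {v i}) = range v"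
    by auto
  ultimately obtain c where "z = (\<Sum>i\<in>UNIV. c i *\<^sub>R v i)" "\<And>i. 0 \<le> c i" "sum c UNIV = 1"
    using assms by auto
  then show ?thesis
    using that by blast
qed

text \<open>Complementary slackness: the products are nonnegative and add up to
  \<open>z \<bullet> z - z \<bullet> z = 0\<close>.\<close>

lemma critical_weights:
  fixes v :: "'i::finite \<Rightarrow> 'a::real_inner"
  assumes "z \<in> critical v" "\<And>i. u i \<ge> 0" "sum u UNIV = 1" "z = (\<Sum>i\<in>UNIV. u i *\<^sub>R v i)"
  shows "u i * (z \<bullet> z - z \<bullet> v i) = 0"
proof -
  have "(\<Sum>i\<in>UNIV. u i * (z \<bullet> z - z \<bullet> v i)) = sum u UNIV * (z \<bullet> z) - z \<bullet> (\<Sum>i\<in>UNIV. u i *\<^sub>R v i)"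
    by (simp add: inner_sum_right sum_subtractf sum_distrib_right right_diff_distrib)
  also have "\<dots> = 0"
    using assms(3,4) by simp
  finally have "(\<Sum>i\<in>UNIV. u i * (z \<bullet> z - z \<bullet> v i)) = 0" .
  moreover have "\<forall>i\<in>UNIV. 0 \<le> u i * (z \<bullet> z - z \<bullet> v i)"
    using assms(1,2) by (auto simp: critical_def)
  ultimately show ?thesis
    using sum_nonneg_eq_0_iff[of UNIV "\<lambda>i. u i * (z \<bullet> z - z \<bullet> v i)"] by simp
qed

text \<open>A critical point is determined by the set of constraints that it makes tight.\<close>

lemma finite_critical:
  fixes v :: "'i::finite \<Rightarrow> 'a::real_inner"
  shows "finite (critical v)"
proof (rule inj_on_finite)
  have same: "z \<bullet> z' = z \<bullet> z"
    if z: "z \<in> critical v" and z': "z' \<in> critical v"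
      and eq: "{j. z \<bullet> v j = z \<bullet> z} = {j. z' \<bullet> v j = z' \<bullet> z'}" for z z'
  proof -
    obtain u where u: "\<And>i. u i \<ge> 0" "sum u UNIV = 1" "z' = (\<Sum>i\<in>UNIV. u i *\<^sub>R v i)"
      using z' hull_range_explicit[of z' v] by (auto simp: critical_def)
    \<comment> \<open>By slackness \<open>u\<close> lives on the constraints tight for
      \<open>z'\<close>, which are the ones tight for \<open>z\<close>.\<close>
    have "u i * (z \<bullet> v i) = u i * (z \<bullet> z)" for i
      using critical_weights[OF z' u, of i] eq by fastforce
    then have "z \<bullet> z' = (\<Sum>i\<in>UNIV. u i * (z \<bullet> z))"
      by (auto simp: u(3) inner_sum_right intro!: sum.cong)
    then show ?thesis
      using u(2) by (simp flip: sum_distrib_right)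
  qed
  show "inj_on (\<lambda>z. {j. z \<bullet> v j = z \<bullet> z}) (critical v)"
  proof (rule inj_onI)
    fix z z' assume "z \<in> critical v" "z' \<in> critical v"
      "{j. z \<bullet> v j = z \<bullet> z} = {j. z' \<bullet> v j = z' \<bullet> z'}"
    then have "(z - z') \<bullet> (z - z') = 0"
      using same[of z z'] same[of z' z] by (simp add: inner_diff inner_commute)
    then show "z = z'"
      by simp
  qed
  show "(\<lambda>z. {j. z \<bullet> v j = z \<bullet> z}) ` critical v \<subseteq> UNIV"
    by simp
qed simp

lemma card_ge_4I:
  assumes "finite A" "distinct [p, q, r, s]" "{p, q, r, s} \<subseteq> A"
  shows "4 \<le> card A"
  using card_mono[OF assms(1,3)] assms(2) by simp

section \<open>Polar simplices and inversion\<close>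

text \<open>
  \<open>v\<close> and \<open>w\<close> are the vertices of two simplices polar to each other, and \<open>l\<close> are the barycentric
  coordinates of the origin, which agree for the two. The axioms are symmetric in \<open>v\<close> and \<open>w\<close>.
\<close>

locale dual_simplices =
  fixes v w :: "'i::finite \<Rightarrow> 'a::real_inner" and l :: "'i \<Rightarrow> real"
  assumes l_pos: "0 < l i"
    and dual_same: "w i \<bullet> v i = 1 - 1 / l i"
    and dual_diff: "i \<noteq> j \<Longrightarrow> w i \<bullet> v j = 1"
    and resolution: "x \<bullet> y = - (\<Sum>i\<in>UNIV. l i * (w i \<bullet> x) * (v i \<bullet> y))"
begin

lemma dual_eq: "w i \<bullet> v j = 1 - (if i = j then 1 / l j else 0)"
  using dual_same dual_diff by auto

lemma swap: "dual_simplices w v l"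
proof
  show "x \<bullet> y = - (\<Sum>i\<in>UNIV. l i * (v i \<bullet> x) * (w i \<bullet> y))" for x y
    using resolution[of y x] by (simp add: inner_commute mult_ac)
qed (use l_pos dual_eq in \<open>auto simp: inner_commute\<close>)

text \<open>Since \<open>l i * (w i \<bullet> v j)\<close> is \<open>l i\<close> minus a Kronecker
  delta, \<open>resolution\<close> at \<open>v j\<close> and \<open>y\<close> has
  \<open>v j \<bullet> y\<close> on both sides; what remains is the claim paired with
  \<open>y\<close>.\<close>

lemma sum_v: "(\<Sum>i\<in>UNIV. l i *\<^sub>R v i) = 0"
proof -
  have "(\<Sum>i\<in>UNIV. l i *\<^sub>R v i) \<bullet> y = 0" for y
  proof -
    fix j :: 'i
    have "l i * (w i \<bullet> v j) * (v i \<bullet> y) = l i * (v i \<bullet> y) - (if i = j then v j \<bullet> y else 0)" for i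
      using l_pos[of i] by (auto simp: dual_eq field_simps)
    then show ?thesis
      using resolution[of "v j" y] by (simp add: sum_subtractf inner_sum_left)
  qed
  from this[of "\<Sum>i\<in>UNIV. l i *\<^sub>R v i"] show ?thesis
    by simp
qed

lemma sum_l: "sum l UNIV = 1"
proof -
  fix j :: 'i
  have "l i * (w j \<bullet> v i) = l i - (if j = i then 1 else 0)" for i
    using l_pos[of i] by (auto simp: dual_eq field_simps)
  then have "w j \<bullet> (\<Sum>i\<in>UNIV. l i *\<^sub>R v i) = sum l UNIV - 1"
    by (simp add: inner_sum_right sum_subtractf)
  then show ?thesis
    by (simp add: sum_v)
qed

lemma nondegenerate:
  assumes "\<And>i. x \<bullet> v i = 0"
  shows "x = 0"
proof -
  have "x \<bullet> x = 0"
    using resolution[of x x] assms by (simp add: inner_commute)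
  then show ?thesis
    by simp
qed

text \<open>The barycentric coordinates of \<open>z\<close> are
  \<open>l i * (1 - w i \<bullet> z)\<close>: they are affine in \<open>z\<close>, equal to 1 at
  \<open>v i\<close> and to 0 at the other vertices. The inequalities say that they are
  nonnegative.\<close>

lemma hull_iff: "z \<in> convex hull (range v) \<longleftrightarrow> (\<forall>j. w j \<bullet> z \<le> 1)"
proof
  assume "z \<in> convex hull (range v)"
  moreover have "convex hull (range v) \<subseteq> {x. w j \<bullet> x \<le> 1}" for j
    using l_pos by (intro hull_minimal) (auto simp: dual_eq convex_halfspace_le less_imp_le)
  ultimately show "\<forall>j. w j \<bullet> z \<le> 1"
    by blast
next
  assume z: "\<forall>j. w j \<bullet> z \<le> 1"
  define x where "x = (\<Sum>i\<in>UNIV. (l i * (1 - w i \<bullet> z)) *\<^sub>R v i)"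
  have "x = (\<Sum>i\<in>UNIV. l i *\<^sub>R v i) - (\<Sum>i\<in>UNIV. (l i * (w i \<bullet> z)) *\<^sub>R v i)"
    unfolding x_def by (simp add: right_diff_distrib scaleR_left_diff_distrib sum_subtractf)
  then have "(z - x) \<bullet> y = 0" for y
    using resolution[of z y] by (simp add: sum_v inner_add_left inner_sum_left)
  from this[of "z - x"] have "z = x"
    by simp
  moreover have "(\<Sum>i\<in>UNIV. l i * (1 - w i \<bullet> z)) = 1"
  proof -
    have "(\<Sum>i\<in>UNIV. l i * (w i \<bullet> z)) = (\<Sum>i\<in>UNIV. l i *\<^sub>R w i) \<bullet> z"
      by (simp add: inner_sum_left)
    also have "\<dots> = 0"
      using dual_simplices.sum_v[OF swap] by simp
    finally show ?thesis
      by (simp add: right_diff_distrib sum_subtractf sum_l)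
  qed
  moreover have "l i * (1 - w i \<bullet> z) \<ge> 0" for i
    using z l_pos[of i] by simp
  then have "x \<in> convex hull (range v)"
    unfolding x_def using calculation(2)
    by (intro convex_sum convex_convex_hull hull_inc) auto
  ultimately show "z \<in> convex hull (range v)"
    by simp
qed

lemma critical_iff: "z \<in> critical v \<longleftrightarrow> z \<noteq> 0 \<and> (\<forall>j. w j \<bullet> z \<le> 1) \<and> (\<forall>j. z \<bullet> v j \<le> z \<bullet> z)"
  by (simp add: critical_def hull_iff)

text \<open>Inversion exchanges the two families of inequalities in \<open>critical_iff\<close>,
  because the image of \<open>z\<close> has squared norm \<open>1 / (z \<bullet> z)\<close>.\<close>

lemma inversion_critical:
  assumes "z \<in> critical v"
  shows "z /\<^sub>R (z \<bullet> z) \<in> critical w"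
proof -
  interpret d: dual_simplices w v l
    by (rule swap)
  have "z \<bullet> z > 0"
    using assms by (auto simp: critical_def)
  with assms show ?thesis
    by (auto simp: critical_iff d.critical_iff inner_commute field_simps)
qed

lemma inversion_inversion: "z \<noteq> 0 \<Longrightarrow> (z /\<^sub>R (z \<bullet> z)) /\<^sub>R ((z /\<^sub>R (z \<bullet> z)) \<bullet> (z /\<^sub>R (z \<bullet> z))) = (z::'a)"
  by (simp add: field_simps)

lemma card_critical_dual: "card (critical w) = card (critical v)"
proof -
  interpret d: dual_simplices w v l
    by (rule swap)
  have "bij_betw (\<lambda>z. z /\<^sub>R (z \<bullet> z)) (critical w) (critical v)"
    by (rule bij_betw_byWitness[where f' = "\<lambda>z. z /\<^sub>R (z \<bullet> z)"])
      (use inversion_critical d.inversion_critical inversion_inversion in \<open>auto simp: critical_def\<close>)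
  then show ?thesis
    by (rule bij_betw_same_card)
qed

text \<open>A second index is demanded because the only vertex of a one-point simplex is the
  origin.\<close>

lemma v_nonzero: "i \<noteq> j \<Longrightarrow> v j \<noteq> 0"
  using dual_diff[of i j] by auto


lemma vertex_critical:
  assumes "\<And>k. v i \<bullet> v k \<le> v i \<bullet> v i" "i \<noteq> j"
  shows "v i \<in> critical v"
  using assms v_nonzero[of j i] by (auto simp: critical_def hull_inc)

end

section \<open>Projections along a vertex and feet on edges\<close>

text \<open>Up to the factor \<open>p \<bullet> p\<close>, the inner product of the projections of \<open>x\<close> and \<open>y\<close> along \<open>p\<close>.\<close>

definition proj_inner :: "'a::real_inner \<Rightarrow> 'a \<Rightarrow> 'a \<Rightarrow> real" where
  "proj_inner p x y = (x \<bullet> y) * (p \<bullet> p) - (x \<bullet> p) * (y \<bullet> p)"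

lemma proj_inner_commute: "proj_inner p x y = proj_inner p y x"
  by (simp add: proj_inner_def inner_commute mult.commute)

text \<open>Up to the factor \<open>(x - y) \<bullet> (x - y)\<close>, the foot of the perpendicular from \<open>0\<close> to the line \<open>xy\<close>.\<close>

definition edge_foot :: "'a::real_inner \<Rightarrow> 'a \<Rightarrow> 'a" where
  "edge_foot x y = (y \<bullet> y - x \<bullet> y) *\<^sub>R x + (x \<bullet> x - x \<bullet> y) *\<^sub>R y"

text \<open>The common value is the Gram determinant of \<open>x\<close> and \<open>y\<close>; that
  the two agree expresses orthogonality to the edge.\<close>

lemma edge_foot_inner_same:
  "edge_foot x y \<bullet> x = (x \<bullet> x) * (y \<bullet> y) - (x \<bullet> y)\<^sup>2"
  "edge_foot x y \<bullet> y = (x \<bullet> x) * (y \<bullet> y) - (x \<bullet> y)\<^sup>2"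
  by (simp_all add: edge_foot_def inner_add_left inner_commute power2_eq_square algebra_simps)

text \<open>Reduces the sign at a further vertex to the signs of two projected inner
  products.\<close>

lemma edge_foot_inner_other: "edge_foot x y \<bullet> u = proj_inner x y u + proj_inner y x u"
  by (simp add: edge_foot_def proj_inner_def inner_add_left inner_commute algebra_simps)

lemma edge_foot_inner_self:
  "edge_foot x y \<bullet> edge_foot x y
    = ((x - y) \<bullet> (x - y)) * ((x \<bullet> x) * (y \<bullet> y) - (x \<bullet> y)\<^sup>2)"
proof -
  have "edge_foot x y \<bullet> edge_foot x y
      = (y \<bullet> y - x \<bullet> y) * (edge_foot x y \<bullet> x) + (x \<bullet> x - x \<bullet> y) * (edge_foot x y \<bullet> y)"
    by (subst (2) edge_foot_def) (simp add: inner_add_right)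
  then show ?thesis
    unfolding edge_foot_inner_same by (simp add: inner_diff inner_commute algebra_simps)
qed

section \<open>Sign conditions for critical points of a tetrahedron\<close>

locale dual_tetrahedra = dual_simplices v w l
  for v w :: "'i::finite \<Rightarrow> 'a::real_inner" and l +
  assumes card_index: "CARD('i) = 4"
begin

lemma UNIV_eq:
  assumes "distinct [a, b, c, d]"
  shows "(UNIV :: 'i set) = {a, b, c, d}"
  by (rule card_subset_eq[symmetric]) (use assms card_index in auto)

lemma sum_UNIV_eq:
  assumes "distinct [a, b, c, d]"
  shows "sum f (UNIV :: 'i set) = f a + f b + f c + (f d :: real)"
  unfolding UNIV_eq[OF assms] using assms by (simp add: add.assoc)

lemma all_iff:
  assumes "distinct [a, b, c, d]"
  shows "(\<forall>i::'i. P i) \<longleftrightarrow> P a \<and> P b \<and> P c \<and> P d"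
  unfolding ball_UNIV[symmetric] UNIV_eq[OF assms] by simp

text \<open>The inner products of \<open>v b\<close> with all vertices, weighted by
  \<open>l\<close>, add up to 0, so the positive ones must be balanced by the remaining one.\<close>

lemma obtuse_vertices:
  assumes "distinct [a, b, c, d]" "v b \<bullet> v a > 0" "v b \<bullet> v c > 0"
  shows "v b \<bullet> v d < 0"
proof -
  have "(\<Sum>i\<in>UNIV. l i * (v b \<bullet> v i)) = v b \<bullet> (\<Sum>i\<in>UNIV. l i *\<^sub>R v i)"
    by (simp add: inner_sum_right)
  then have "l a * (v b \<bullet> v a) + l b * (v b \<bullet> v b) + l c * (v b \<bullet> v c) + l d * (v b \<bullet> v d) = 0"
    by (simp add: sum_v sum_UNIV_eq[OF assms(1)])
  moreover have "l a * (v b \<bullet> v a) > 0" "l c * (v b \<bullet> v c) > 0" "l b * (v b \<bullet> v b) \<ge> 0"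
    using assms l_pos by (simp_all add: less_imp_le)
  ultimately have "l d * (v b \<bullet> v d) < 0"
    by linarith
  then show ?thesis
    using l_pos[of d] by (simp add: mult_less_0_iff)
qed

text \<open>Projecting along \<open>v p\<close> kills the vertex \<open>p\<close>. Three terms of
  the weighted sum remain, one of them a nonnegative square, so a single positive one forces the
  last to be negative.\<close>

lemma obtuse_projections:
  assumes "distinct [p, a, b, c]" "proj_inner (v p) (v b) (v a) > 0"
  shows "proj_inner (v p) (v b) (v c) < 0"
proof -
  have "(\<Sum>i\<in>UNIV. l i * proj_inner (v p) (v b) (v i))
      = proj_inner (v p) (v b) (\<Sum>i\<in>UNIV. l i *\<^sub>R v i)"
    by (simp add: proj_inner_def inner_sum_right inner_sum_left sum_distrib_right sum_distrib_left
        right_diff_distrib sum_subtractf mult_ac)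
  then have "(\<Sum>i\<in>UNIV. l i * proj_inner (v p) (v b) (v i)) = 0"
    by (simp add: sum_v proj_inner_def)
  moreover have "proj_inner (v p) (v b) (v p) = 0"
    by (simp add: proj_inner_def)
  ultimately have "l a * proj_inner (v p) (v b) (v a) + l b * proj_inner (v p) (v b) (v b)
      + l c * proj_inner (v p) (v b) (v c) = 0"
    by (simp add: sum_UNIV_eq[OF assms(1)])
  moreover have "l a * proj_inner (v p) (v b) (v a) > 0"
    using assms l_pos by simp
  moreover have "l b * proj_inner (v p) (v b) (v b) \<ge> 0"
    using l_pos[of b] Cauchy_Schwarz_ineq[of "v b" "v p"]
    by (simp add: proj_inner_def power2_eq_square)
  ultimately have "l c * proj_inner (v p) (v b) (v c) < 0"
    by linarith
  then show ?thesis
    using l_pos[of c] by (simp add: mult_less_0_iff)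
qed

text \<open>
  The conclusion says that the foot of the perpendicular to the face opposite \<open>v i\<close> is on the same
  side of its edge from \<open>v k\<close> to \<open>v m\<close> as the face itself. Below, \<open>D w\<^sub>i - Z\<close> and \<open>w\<^sub>i - w\<^sub>j\<close> are both
  orthogonal to \<open>v k\<close> and \<open>v m\<close>, hence proportional.
\<close>

lemma acute_faces_if_edge_foot:
  assumes "distinct [i, j, k, m]" "edge_foot (v k) (v m) \<bullet> v j < 0"
  shows "w i \<bullet> w j < w i \<bullet> w i"
proof -
  define Z where "Z = edge_foot (v k) (v m)"
  define D where "D = (v k \<bullet> v k) * (v m \<bullet> v m) - (v k \<bullet> v m)\<^sup>2"
  \<comment> \<open>This factor makes \<open>r\<close> orthogonal to \<open>v j\<close>, as
    \<open>(w i - w j) \<bullet> v j = 1 / l j\<close>.\<close>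
  define t where "t = l j * (D - Z \<bullet> v j)"
  have "D \<ge> 0"
    using Cauchy_Schwarz_ineq[of "v k" "v m"] by (simp add: D_def)
  then have "t > 0"
    using assms(2) l_pos[of j] by (simp add: t_def Z_def)
  define r where "r = D *\<^sub>R w i - Z - t *\<^sub>R (w i - w j)"
  have rv: "r \<bullet> v k = 0" "r \<bullet> v m = 0" "r \<bullet> v j = 0"
    using assms(1) l_pos[of j]
    by (auto simp: r_def t_def D_def Z_def edge_foot_inner_same inner_diff_left dual_eq)
  \<comment> \<open>The weighted vertices add up to 0, so orthogonality to three of them implies it
    for the fourth.\<close>
  have "(\<Sum>n\<in>UNIV. l n * (r \<bullet> v n)) = r \<bullet> (\<Sum>n\<in>UNIV. l n *\<^sub>R v n)"
    by (simp add: inner_sum_right)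
  then have "r \<bullet> v i = 0"
    using l_pos[of i] by (simp add: rv sum_v sum_UNIV_eq[OF assms(1)])
  then have "\<forall>n. r \<bullet> v n = 0"
    using rv by (simp add: all_iff[OF assms(1)])
  then have "r = 0"
    using nondegenerate by blast
  then have "(D *\<^sub>R w i - Z) \<bullet> (w i - w j) = t * ((w i - w j) \<bullet> (w i - w j))"
    by (simp add: r_def)
  moreover have "Z \<bullet> (w i - w j) = 0"
    using assms(1)
    by (auto simp: Z_def edge_foot_def inner_add_left inner_diff_right inner_commute[of "v _" "w _"] dual_eq)
  ultimately have eq: "D * (w i \<bullet> (w i - w j)) = t * ((w i - w j) \<bullet> (w i - w j))"
    by (simp add: inner_diff_left)
  have "w i \<noteq> w j"
    using dual_same[of j] dual_diff[of i j] l_pos[of j] assms(1) by auto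
  then have "D * (w i \<bullet> (w i - w j)) > 0"
    unfolding eq using \<open>t > 0\<close> by simp
  then have "w i \<bullet> (w i - w j) > 0"
    using \<open>D \<ge> 0\<close> by (simp add: zero_less_mult_iff)
  then show ?thesis
    by (simp add: inner_diff_right)
qed

text \<open>The point is the foot of the perpendicular to the plane
  \<open>w i \<bullet> x = 1\<close> of the face opposite \<open>v i\<close>. Each hypothesis
  handles one edge of this face; together they make \<open>w i\<close> critical for
  \<open>w\<close>, and inversion carries this over to \<open>v\<close>.\<close>

lemma face_foot_critical:
  assumes "distinct [i, j, k, m]" "edge_foot (v k) (v m) \<bullet> v j < 0"
    "edge_foot (v j) (v m) \<bullet> v k < 0" "edge_foot (v j) (v k) \<bullet> v m < 0"
  shows "w i /\<^sub>R (w i \<bullet> w i) \<in> critical v"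
proof -
  interpret d: dual_simplices w v l
    by (rule swap)
  have "w i \<bullet> w j < w i \<bullet> w i" "w i \<bullet> w k < w i \<bullet> w i" "w i \<bullet> w m < w i \<bullet> w i"
    using assms by (auto intro!: acute_faces_if_edge_foot[of i j k m]
        acute_faces_if_edge_foot[of i k j m] acute_faces_if_edge_foot[of i m j k])
  then have "\<forall>n. w i \<bullet> w n \<le> w i \<bullet> w i"
    by (simp add: all_iff[OF assms(1)])
  then show ?thesis
    using assms(1) by (auto intro!: d.inversion_critical d.vertex_critical[of i j])
qed

text \<open>The obtuse angle at the origin puts the foot \<open>z\<close> between the two vertices.
  Their constraints are tight, and the other two hold since \<open>z \<bullet> z\<close> is
  nonnegative.\<close>

lemma edge_foot_critical:
  assumes ij: "distinct [i, j, k, m]" and obtuse: "v i \<bullet> v j < 0"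
    and neg: "edge_foot (v i) (v j) \<bullet> v k < 0" "edge_foot (v i) (v j) \<bullet> v m < 0"
  shows "edge_foot (v i) (v j) /\<^sub>R ((v i - v j) \<bullet> (v i - v j)) \<in> critical v"
proof -
  define s where "s = (v i - v j) \<bullet> (v i - v j)"
  define x where "x = (v j \<bullet> v j - v i \<bullet> v j) / s"
  define y where "y = (v i \<bullet> v i - v i \<bullet> v j) / s"
  define z where "z = edge_foot (v i) (v j) /\<^sub>R s"
  have s: "s = (v j \<bullet> v j - v i \<bullet> v j) + (v i \<bullet> v i - v i \<bullet> v j)"
    by (simp add: s_def inner_diff inner_commute)
  have "v j \<bullet> v j \<ge> 0" "v i \<bullet> v i \<ge> 0"
    by simp_all
  then have "s > 0"
    using obtuse s by linarith
  then have "x + y = 1"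
    unfolding x_def y_def add_divide_distrib[symmetric] s[symmetric] by simp
  moreover have "v j \<bullet> v j - v i \<bullet> v j \<ge> 0" "v i \<bullet> v i - v i \<bullet> v j \<ge> 0"
    using obtuse \<open>v j \<bullet> v j \<ge> 0\<close> \<open>v i \<bullet> v i \<ge> 0\<close> by linarith+
  then have "x \<ge> 0" "y \<ge> 0"
    using \<open>s > 0\<close> by (simp_all add: x_def y_def)
  moreover have z: "z = x *\<^sub>R v i + y *\<^sub>R v j"
    by (simp add: z_def edge_foot_def x_def y_def scaleR_add_right divide_inverse mult.commute)
  ultimately have "z \<in> convex hull (range v)"
    unfolding z by (intro convexD[OF convex_convex_hull]) (auto simp: hull_inc)
  \<comment> \<open>\<open>w k\<close> takes the value 1 on the whole line through
    \<open>v i\<close> and \<open>v j\<close>, so this line misses the origin.\<close>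
  moreover have "z \<noteq> 0"
  proof
    assume "z = 0"
    then have "w k \<bullet> z = 0"
      by simp
    then show False
      using ij \<open>x + y = 1\<close> by (auto simp: z inner_add_right dual_eq)
  qed
  moreover have "z \<bullet> v i = z \<bullet> z" "z \<bullet> v j = z \<bullet> z"
    using \<open>s > 0\<close> by (simp_all add: z_def edge_foot_inner_same edge_foot_inner_self flip: s_def)
  moreover have "z \<bullet> v k < 0" "z \<bullet> v m < 0"
    using neg \<open>s > 0\<close> by (simp_all add: z_def mult_less_0_iff zero_less_mult_iff)
  then have "z \<bullet> v k \<le> z \<bullet> z" "z \<bullet> v m \<le> z \<bullet> z"
    using inner_ge_zero[of z] by linarith+
  ultimately show ?thesis
    by (auto simp: critical_def all_iff[OF ij] simp flip: s_def z_def)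
qed

lemma index_exhaust:
  fixes i :: 'i
  assumes "distinct [a, b, c, d]"
  obtains "i = a" | "i = b" | "i = c" | "i = d"
  using UNIV_eq[OF assms] by blast

lemma v_inj: "i \<noteq> j \<Longrightarrow> v i \<noteq> v j"
  using dual_same[of i] dual_diff[of i j] l_pos[of i] by auto

text \<open>Meant to be applied to the path in both directions; the reversed path supplies the
  mirrored signs.\<close>

lemma acute_path_signs:
  assumes "distinct [a, b, c, d]" "v a \<bullet> v b > 0" "v b \<bullet> v c > 0" "v c \<bullet> v d > 0"
  shows "v a \<bullet> v c < 0" "v b \<bullet> v d < 0" "v a \<bullet> v d < 0"
    "proj_inner (v d) (v b) (v a) < 0" "proj_inner (v d) (v c) (v a) < 0"
    "proj_inner (v c) (v a) (v d) < 0"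
proof -
  have "v c \<bullet> v a < 0"
    by (rule obtuse_vertices[of b c d a]) (use assms in \<open>auto simp: inner_commute\<close>)
  then show ac: "v a \<bullet> v c < 0"
    by (simp add: inner_commute)
  show bd: "v b \<bullet> v d < 0"
    by (rule obtuse_vertices[of a b c d]) (use assms in \<open>auto simp: inner_commute\<close>)
  have "v d \<bullet> v d > 0" "v c \<bullet> v c > 0"
    using v_nonzero assms(1) by auto
  \<comment> \<open>Both parts of \<open>proj_inner\<close> contribute positively, because
    \<open>v b \<bullet> v d\<close> is negative and \<open>v c \<bullet> v d\<close>
    positive.\<close>
  have dbc: "proj_inner (v d) (v b) (v c) > 0"
    using mult_pos_pos[OF assms(3) \<open>v d \<bullet> v d > 0\<close>] mult_neg_pos[OF bd assms(4)]
    by (simp add: proj_inner_def)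
  show dba: "proj_inner (v d) (v b) (v a) < 0"
    by (rule obtuse_projections[of d c b a]) (use assms dbc in auto)
  show "proj_inner (v d) (v c) (v a) < 0"
    by (rule obtuse_projections[of d b c a])
      (use assms dbc in \<open>auto simp: proj_inner_commute[of _ "v c" "v b"]\<close>)
  have "proj_inner (v c) (v a) (v b) > 0"
    using mult_pos_pos[OF assms(2) \<open>v c \<bullet> v c > 0\<close>] mult_neg_pos[OF ac assms(3)]
    by (simp add: proj_inner_def)
  then show "proj_inner (v c) (v a) (v d) < 0"
    by (intro obtuse_projections[of c b a d]) (use assms in auto)
  \<comment> \<open>As \<open>v a \<bullet> v b\<close> is positive, the projected inner product
    \<open>dba\<close> is negative only if the subtracted product is positive.\<close>
  have "(v b \<bullet> v d) * (v a \<bullet> v d) > 0"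
    using dba mult_pos_pos[OF assms(2) \<open>v d \<bullet> v d > 0\<close>] by (simp add: proj_inner_def inner_commute)
  then show "v a \<bullet> v d < 0"
    using bd by (simp add: zero_less_mult_iff)
qed

text \<open>The signs for the path and its reversal make every term of
  \<open>edge_foot_inner_other\<close> negative for the edges concerned. The four points are told
  apart by the signs of their inner products with the vertices.\<close>

lemma acute_path_four_critical:
  assumes dist: "distinct [a, b, c, d]"
    and acute: "v a \<bullet> v b > 0" "v b \<bullet> v c > 0" "v c \<bullet> v d > 0"
    and top: "\<And>k. v i \<bullet> v k \<le> v i \<bullet> v i"
  shows "4 \<le> card (critical v)"
proof -
  have dist': "distinct [d, c, b, a]"
    using dist by auto
  have acute': "v d \<bullet> v c > 0" "v c \<bullet> v b > 0" "v b \<bullet> v a > 0"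
    using acute by (simp_all add: inner_commute)
  note s = acute_path_signs[OF dist acute] acute_path_signs[OF dist' acute']
  define q where "q = w b /\<^sub>R (w b \<bullet> w b)"
  define r where "r = w c /\<^sub>R (w c \<bullet> w c)"
  define e where "e = edge_foot (v a) (v d) /\<^sub>R ((v a - v d) \<bullet> (v a - v d))"
  have neg: "edge_foot (v a) (v d) \<bullet> v b < 0" "edge_foot (v a) (v d) \<bullet> v c < 0"
    "edge_foot (v a) (v c) \<bullet> v d < 0" "edge_foot (v c) (v d) \<bullet> v a < 0"
    "edge_foot (v b) (v d) \<bullet> v a < 0" "edge_foot (v a) (v b) \<bullet> v d < 0"
    using s by (simp_all add: edge_foot_inner_other proj_inner_commute)
  have q: "q \<in> critical v"
    unfolding q_def by (rule face_foot_critical[of b a c d]) (use dist neg in auto)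
  have r: "r \<in> critical v"
    unfolding r_def by (rule face_foot_critical[of c a b d]) (use dist neg in auto)
  have e: "e \<in> critical v"
    unfolding e_def by (rule edge_foot_critical[of a d b c]) (use dist neg s in auto)
  have ne: "b \<noteq> a" "c \<noteq> a"
    using dist by auto
  have t: "v i \<in> critical v"
    using top ne vertex_critical by metis
  \<comment> \<open>Hence \<open>w b \<bullet> v b\<close> and \<open>w c \<bullet> v c\<close>,
    which are \<open>1 - 1 / l b\<close> and \<open>1 - 1 / l c\<close>, are negative.\<close>
  have "l b < 1" "l c < 1"
    using sum_l l_pos[of a] l_pos[of b] l_pos[of c] l_pos[of d]
    unfolding sum_UNIV_eq[OF dist] by linarith+
  moreover have "w b \<bullet> w b > 0" "w c \<bullet> w c > 0"
    using dual_simplices.v_nonzero[OF swap] ne by (metis inner_gt_zero_iff)+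
  ultimately have qv: "q \<bullet> v a > 0" "q \<bullet> v b < 0" "q \<bullet> v c > 0" "q \<bullet> v d > 0"
    and rv: "r \<bullet> v a > 0" "r \<bullet> v b > 0" "r \<bullet> v c < 0" "r \<bullet> v d > 0"
    using dist l_pos[of b] l_pos[of c] by (auto simp: q_def r_def dual_eq field_simps)
  have "(v a - v d) \<bullet> (v a - v d) > 0"
    using v_inj[of a d] dist by simp
  then have ev: "e \<bullet> v b < 0" "e \<bullet> v c < 0"
    using neg by (simp_all add: e_def mult_less_0_iff zero_less_mult_iff)
  have ev': "e \<bullet> v a \<ge> 0" "e \<bullet> v d \<ge> 0"
    using Cauchy_Schwarz_ineq[of "v a" "v d"] by (simp_all add: e_def edge_foot_inner_same)
  have pos: "\<not> v n \<bullet> v n < 0" for n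
    by (simp add: not_less)
  have "v i \<noteq> q"
    by (rule index_exhaust[OF dist, of i]) (use qv s in \<open>auto simp: pos inner_commute\<close>)
  moreover have "v i \<noteq> r"
    by (rule index_exhaust[OF dist, of i]) (use rv s in \<open>auto simp: pos inner_commute\<close>)
  moreover have "v i \<noteq> e"
    by (rule index_exhaust[OF dist, of i]) (use ev ev' s in \<open>auto simp: pos inner_commute\<close>)
  moreover have "q \<noteq> r" "q \<noteq> e" "r \<noteq> e"
    using qv rv ev by auto
  ultimately show ?thesis
    using q r e t by (intro card_ge_4I[of _ "v i" q r e] finite_critical) auto
qed

section \<open>Hamiltonian paths in graphs on four vertices\<close>

lemma doubleton_neq_UNIV: "{x, y} \<noteq> (UNIV :: 'i set)"
proof
  assume "{x, y} = UNIV"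
  then have "card {x, y} = 4"
    using card_index by simp
  then show False
    by (simp add: card_insert_if split: if_splits)
qed

text \<open>A connected graph on four vertices without a Hamiltonian path is a star, whose centre is
  adjacent to all others. \<open>cut\<close> is connectivity and \<open>deg\<close> excludes the
  star; with the six possible edges as atoms the claim is propositional.\<close>

lemma Hamiltonian_path:
  assumes sym: "\<And>x y. E x y \<Longrightarrow> E y x"
    and cut: "\<And>S. S \<noteq> {} \<Longrightarrow> S \<noteq> UNIV \<Longrightarrow> \<exists>x\<in>S. \<exists>y\<in>-S. E x y"
    and deg: "\<And>x. \<exists>y. y \<noteq> x \<and> \<not> E x y"
  shows "\<exists>a b c d :: 'i. distinct [a, b, c, d] \<and> E a b \<and> E b c \<and> E c d"
proof -
  obtain xs :: "'i list" where "set xs = UNIV" "distinct xs"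
    using finite_distinct_list[of "UNIV :: 'i set"] by auto
  moreover from this have "length xs = 4"
    using card_index distinct_card by fastforce
  ultimately obtain a b c d :: 'i where dist: "distinct [a, b, c, d]"
    by (auto simp: length_Suc_conv numeral_eq_Suc)
  have singleton_neq_UNIV: "{x} \<noteq> UNIV" for x :: 'i
    using doubleton_neq_UNIV[of x x] by simp
  have S: "E b a = E a b" "E c a = E a c" "E d a = E a d" "E c b = E b c" "E d b = E b d" "E d c = E c d"
    using sym by blast+
  have ex: "(\<exists>y. Q y) \<longleftrightarrow> Q a \<or> Q b \<or> Q c \<or> Q d" for Q
    using all_iff[OF dist, of "\<lambda>x. \<not> Q x"] by blast
  have cut': "\<exists>x. x \<in> S \<and> (\<exists>y. y \<notin> S \<and> E x y)" if "S \<noteq> {}" "S \<noteq> UNIV" for S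
    using cut[OF that] by blast
  have D: "a \<noteq> b" "a \<noteq> c" "a \<noteq> d" "b \<noteq> c" "b \<noteq> d" "c \<noteq> d"
    "b \<noteq> a" "c \<noteq> a" "d \<noteq> a" "c \<noteq> b" "d \<noteq> b" "d \<noteq> c"
    using dist by auto
  have "E a b \<or> E a c \<or> E a d" "E a b \<or> E b c \<or> E b d" "E a c \<or> E b c \<or> E c d" "E a d \<or> E b d \<or> E c d"
    using cut'[OF _ singleton_neq_UNIV[of a]] cut'[OF _ singleton_neq_UNIV[of b]] cut'[OF _ singleton_neq_UNIV[of c]] cut'[OF _ singleton_neq_UNIV[of d]]
    unfolding ex S by (simp_all add: D)
  moreover have "E a c \<or> E a d \<or> E b c \<or> E b d" "E a b \<or> E a d \<or> E b c \<or> E c d"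
    "E a b \<or> E a c \<or> E b d \<or> E c d"
    using cut'[OF _ doubleton_neq_UNIV[of a b]] cut'[OF _ doubleton_neq_UNIV[of a c]] cut'[OF _ doubleton_neq_UNIV[of a d]]
    unfolding ex S by (auto simp: D)
  moreover have "\<not> (E a b \<and> E a c \<and> E a d)" "\<not> (E a b \<and> E b c \<and> E b d)"
    "\<not> (E a c \<and> E b c \<and> E c d)" "\<not> (E a d \<and> E b d \<and> E c d)"
    using deg[of a] deg[of b] deg[of c] deg[of d] unfolding ex S by (auto simp: D)
  \<comment> \<open>The twelve disjuncts are the orderings of four vertices up to reversal.\<close>
  ultimately have "(E a b \<and> E b c \<and> E c d) \<or> (E a b \<and> E b d \<and> E d c) \<or> (E a c \<and> E c b \<and> E b d)
      \<or> (E a c \<and> E c d \<and> E d b) \<or> (E a d \<and> E d b \<and> E b c) \<or> (E a d \<and> E d c \<and> E c b)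
      \<or> (E b a \<and> E a c \<and> E c d) \<or> (E b a \<and> E a d \<and> E d c) \<or> (E b c \<and> E c a \<and> E a d)
      \<or> (E b d \<and> E d a \<and> E a c) \<or> (E c b \<and> E b a \<and> E a d) \<or> (E d b \<and> E b a \<and> E a c)"
    unfolding S by argo
  moreover have "distinct [a, b, d, c]" "distinct [a, c, b, d]" "distinct [a, c, d, b]"
    "distinct [a, d, b, c]" "distinct [a, d, c, b]" "distinct [b, a, c, d]" "distinct [b, a, d, c]"
    "distinct [b, c, a, d]" "distinct [b, d, a, c]" "distinct [c, b, a, d]" "distinct [d, b, a, c]"
    using dist by auto
  ultimately show ?thesis
    using dist by metis
qed

section \<open>Strict tops and the lower bound\<close>

text \<open>
  The strict inequality makes a strict top differ from the foot of the perpendicular to any face.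
\<close>

definition strict_top :: "'i \<Rightarrow> bool" where
  "strict_top i \<longleftrightarrow> (\<forall>j. j \<noteq> i \<longrightarrow> v i \<bullet> v j < v i \<bullet> v i)"

text \<open>With at most one strict top, a set or its complement contains none. An acute pair leaves
  the one that contains none, so the graph of acute pairs is connected.\<close>

lemma few_strict_tops_four_critical:
  assumes uniq: "\<And>i j. strict_top i \<Longrightarrow> strict_top j \<Longrightarrow> i = j"
  shows "4 \<le> card (critical v)"
proof -
  \<comment> \<open>Let \<open>v x\<close> be longest in \<open>S\<close>. A \<open>v y\<close> with
    \<open>v x \<bullet> v x \<le> v x \<bullet> v y\<close> is longer still, hence outside
    \<open>S\<close>.\<close>
  have escape: "\<exists>x\<in>S. \<exists>y\<in>-S. v x \<bullet> v y > 0" if S: "S \<noteq> {}" "\<And>i. i \<in> S \<Longrightarrow> \<not> strict_top i" for S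
  proof -
    have "Max ((\<lambda>i. v i \<bullet> v i) ` S) \<in> (\<lambda>i. v i \<bullet> v i) ` S"
      using S(1) by (intro Max_in) auto
    then obtain x where x: "x \<in> S" "v x \<bullet> v x = Max ((\<lambda>i. v i \<bullet> v i) ` S)"
      by auto
    have max: "v y \<bullet> v y \<le> v x \<bullet> v x" if "y \<in> S" for y
      unfolding x(2) using that by (intro Max_ge) auto
    obtain y where y: "y \<noteq> x" "v x \<bullet> v x \<le> v x \<bullet> v y"
      using S(2)[OF x(1)] by (auto simp: strict_top_def not_less)
    have "y \<notin> S"
    proof
      assume "y \<in> S"
      then have "(v x - v y) \<bullet> (v x - v y) \<le> 0"
        using max[of y] y(2) by (simp add: inner_diff inner_commute)
      then show False
        using v_inj[OF y(1)] by (metis eq_iff_diff_eq_0 inner_gt_zero_iff not_less)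
    qed
    moreover have "v x \<bullet> v x > 0"
      using v_nonzero[OF y(1)] by simp
    then have "v x \<bullet> v y > 0"
      using y(2) by linarith
    ultimately show ?thesis
      using x(1) by auto
  qed
  have "\<exists>x\<in>S. \<exists>y\<in>-S. v x \<bullet> v y > 0" if S: "S \<noteq> {}" "S \<noteq> UNIV" for S
  proof (cases "\<exists>i\<in>S. strict_top i")
    case True
    then have "\<exists>x\<in>-S. \<exists>y\<in>- (-S). v x \<bullet> v y > 0"
      using S uniq by (intro escape) auto
    then show ?thesis
      by (metis ComplD ComplI inner_commute)
  next
    case False
    then show ?thesis
      using S by (intro escape) auto
  qed
  \<comment> \<open>Otherwise a vanishing sum with positive weights would have only nonnegative
    terms, some of them positive.\<close>
  moreover have "\<exists>y. y \<noteq> x \<and> \<not> v x \<bullet> v y > 0" for x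
  proof (rule ccontr)
    assume all: "\<nexists>y. y \<noteq> x \<and> \<not> v x \<bullet> v y > 0"
    have "(\<Sum>i\<in>UNIV. l i * (v x \<bullet> v i)) = v x \<bullet> (\<Sum>i\<in>UNIV. l i *\<^sub>R v i)"
      by (simp add: inner_sum_right)
    then have "(\<Sum>i\<in>UNIV. l i * (v x \<bullet> v i)) = 0"
      by (simp add: sum_v)
    moreover have "l i * (v x \<bullet> v i) \<ge> 0" for i
      using all l_pos[of i] by (cases "i = x") (auto simp: less_imp_le)
    ultimately have "\<forall>i. l i * (v x \<bullet> v i) = 0"
      using sum_nonneg_eq_0_iff[of UNIV "\<lambda>i. l i * (v x \<bullet> v i)"] by simp
    then have "\<forall>i. v x \<bullet> v i = 0"
      using l_pos by (metis less_irrefl mult_eq_0_iff)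
    then have "\<forall>i. i = x"
      using all by (metis less_irrefl)
    then show False
      using doubleton_neq_UNIV[of x x] by auto
  qed
  ultimately obtain a b c d where path: "distinct [a, b, c, d]" "v a \<bullet> v b > 0" "v b \<bullet> v c > 0" "v c \<bullet> v d > 0"
    using Hamiltonian_path[of "\<lambda>x y. v x \<bullet> v y > 0"] by (auto simp: inner_commute)
  have "Max (range (\<lambda>i. norm (v i))) \<in> range (\<lambda>i. norm (v i))"
    by (intro Max_in) auto
  then obtain i where i: "norm (v i) = Max (range (\<lambda>i. norm (v i)))"
    by (metis imageE)
  have "v i \<bullet> v k \<le> v i \<bullet> v i" for k
  proof -
    have "v i \<bullet> v k \<le> norm (v i) * norm (v k)"
      by (rule norm_cauchy_schwarz)
    also have "norm (v k) \<le> norm (v i)"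
      unfolding i by (intro Max_ge) auto
    finally show ?thesis
      by (simp add: dot_square_norm power2_eq_square mult_left_mono)
  qed
  then show ?thesis
    by (rule acute_path_four_critical[OF path])
qed

theorem four_critical: "4 \<le> card (critical v)"
proof -
  interpret d: dual_tetrahedra w v l
    by (intro dual_tetrahedra.intro swap dual_tetrahedra_axioms.intro card_index)
  consider "\<And>i j. strict_top i \<Longrightarrow> strict_top j \<Longrightarrow> i = j"
    | "\<And>i j. d.strict_top i \<Longrightarrow> d.strict_top j \<Longrightarrow> i = j"
    | i j m n where "i \<noteq> j" "strict_top i" "strict_top j" "m \<noteq> n" "d.strict_top m" "d.strict_top n"
    by blast
  then show ?thesis
  proof cases
    case 1
    then show ?thesis
      by (rule few_strict_tops_four_critical)
  next
    case 2
    then show ?thesis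
      using d.few_strict_tops_four_critical card_critical_dual by simp
  next
    case 3
    have v: "v k \<in> critical v" if "strict_top k" for k
    proof (rule vertex_critical)
      show "v k \<bullet> v k' \<le> v k \<bullet> v k" for k'
        using that by (cases "k' = k") (auto simp: strict_top_def less_imp_le)
      show "k \<noteq> (if k = i then j else i)"
        using 3(1) by auto
    qed
    have w: "w k /\<^sub>R (w k \<bullet> w k) \<in> critical v" if "d.strict_top k" for k
    proof (rule d.inversion_critical, rule d.vertex_critical)
      show "w k \<bullet> w k' \<le> w k \<bullet> w k" for k'
        using that by (cases "k' = k") (auto simp: d.strict_top_def less_imp_le)
      show "k \<noteq> (if k = i then j else i)"
        using 3(1) by auto
    qed
    have vw: "v k \<noteq> w k' /\<^sub>R (w k' \<bullet> w k')" if "strict_top k" for k k'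
    proof
      assume eq: "v k = w k' /\<^sub>R (w k' \<bullet> w k')"
      \<comment> \<open>The foot on the plane of a face meets the constraints of all vertices of
        this face with equality, and \<open>v p\<close> is such a vertex other than
        \<open>v k\<close>.\<close>
      obtain p where p: "p \<noteq> k" "p \<noteq> k'"
        using doubleton_neq_UNIV[of k k'] by blast
      then have "v k \<bullet> v p = v k \<bullet> v k"
        using dual_diff[of k' p] d.v_nonzero[of p k'] by (simp add: eq)
      then show False
        using that p(1) by (auto simp: strict_top_def)
    qed
    have "w m /\<^sub>R (w m \<bullet> w m) \<noteq> w n /\<^sub>R (w n \<bullet> w n)"
    proof
      assume eq: "w m /\<^sub>R (w m \<bullet> w m) = w n /\<^sub>R (w n \<bullet> w n)"
      have "w m = w n"
        using inversion_inversion[of "w m"] inversion_inversion[of "w n"] d.v_nonzero 3(4)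
        unfolding eq by metis
      then show False
        using d.v_inj 3(4) by blast
    qed
    moreover have "v i \<noteq> v j"
      using v_inj 3(1) by blast
    ultimately show ?thesis
      using 3 v w vw
      by (intro card_ge_4I[of _ "v i" "v j" "w m /\<^sub>R (w m \<bullet> w m)" "w n /\<^sub>R (w n \<bullet> w n)"]
          finite_critical) auto
  qed
qed

end

section \<open>From normals to critical points\<close>

text \<open>At a base the outer normal \<open>a\<close> of the support plane is a positive multiple
  of \<open>z - y\<close>, so \<open>z\<close> determines the plane.\<close>

lemma normal_base_iff:
  assumes y: "y \<in> interior P"
  shows "normal_base P y z \<longleftrightarrow> z \<noteq> y \<and> z \<in> P \<and> (\<forall>x\<in>P. (z - y) \<bullet> (x - z) \<le> 0)"
proof
  assume "normal_base P y z"
  then obtain a b where a: "a \<noteq> 0" "P \<subseteq> {x. a \<bullet> x \<le> b}" and z: "a \<bullet> z = b" "z \<in> P"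
    and orth: "segment_orthogonal_to_plane y z {x. a \<bullet> x = b}"
    by (auto simp: normal_base_def support_plane_def)
  define k where "k = ((z - y) \<bullet> a) / (a \<bullet> a)"
  \<comment> \<open>\<open>r\<close> is the part of \<open>z - y\<close> parallel to the plane;
    orthogonality makes it vanish.\<close>
  define r where "r = (z - y) - k *\<^sub>R a"
  have "a \<bullet> r = 0"
    using a(1) by (simp add: r_def k_def inner_diff_right inner_commute)
  then have "z + r \<in> {x. a \<bullet> x = b}"
    using z(1) by (simp add: inner_add_right)
  then have "(z - y) \<bullet> (z + r - z) = 0"
    using orth z(1) unfolding segment_orthogonal_to_plane_def orthogonal_def by blast
  moreover have "r \<bullet> r = (z - y) \<bullet> r - k * (a \<bullet> r)"
    by (subst (1) r_def) (simp add: inner_diff_left)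
  ultimately have "r \<bullet> r = 0"
    using \<open>a \<bullet> r = 0\<close> by simp
  then have zy: "z - y = k *\<^sub>R a"
    by (simp add: r_def)
  obtain \<epsilon> where \<epsilon>: "\<epsilon> > 0" "cball y \<epsilon> \<subseteq> P"
    using y by (auto simp: mem_interior_cball)
  \<comment> \<open>A ball around \<open>y\<close> reaches beyond \<open>y\<close> in direction
    \<open>a\<close>, so \<open>a \<bullet> y < b\<close> and \<open>k\<close> is positive.\<close>
  have "y + (\<epsilon> / norm a) *\<^sub>R a \<in> P"
    using \<epsilon> a(1) by (intro subsetD[OF \<epsilon>(2)]) (auto simp: dist_norm)
  then have "a \<bullet> (y + (\<epsilon> / norm a) *\<^sub>R a) \<le> b"
    using a(2) by blast
  moreover have "(\<epsilon> / norm a) * (a \<bullet> a) > 0"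
    using \<epsilon>(1) a(1) by simp
  ultimately have "a \<bullet> (z - y) > 0"
    using z(1) by (simp add: inner_add_right inner_diff_right)
  then have "k > 0" "z \<noteq> y"
    using a(1) by (auto simp: k_def inner_commute)
  moreover have "(z - y) \<bullet> (x - z) \<le> 0" if "x \<in> P" for x
    using that a(2) z(1) \<open>k > 0\<close> by (auto simp: zy inner_diff_right mult_le_0_iff)
  ultimately show "z \<noteq> y \<and> z \<in> P \<and> (\<forall>x\<in>P. (z - y) \<bullet> (x - z) \<le> 0)"
    using z(2) by blast
next
  assume z: "z \<noteq> y \<and> z \<in> P \<and> (\<forall>x\<in>P. (z - y) \<bullet> (x - z) \<le> 0)"
  define h where "h = {x. (z - y) \<bullet> x = (z - y) \<bullet> z}"
  have "support_plane P h"
    unfolding support_plane_def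
    by (intro exI[of _ "z - y"] exI[of _ "(z - y) \<bullet> z"]) (use z in \<open>auto simp: h_def inner_diff_right\<close>)
  moreover have "z \<in> h \<inter> P"
    using z by (simp add: h_def)
  moreover have "segment_orthogonal_to_plane y z h"
    by (simp add: segment_orthogonal_to_plane_def orthogonal_def h_def inner_diff_right)
  ultimately show "normal_base P y z"
    unfolding normal_base_def by blast
qed

lemma num_normals_eq_card_critical:
  fixes c :: "'i::finite \<Rightarrow> real^3"
  assumes y: "y \<in> interior (convex hull (range c))"
  shows "num_normals (convex hull (range c)) y = card (critical (\<lambda>i. c i - y))"
proof -
  define P where "P = convex hull (range c)"
  have P: "z - y \<in> convex hull (range (\<lambda>i. c i - y)) \<longleftrightarrow> z \<in> P" for z
  proof -
    have "range (\<lambda>i. c i - y) = (+) (- y) ` range c"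
      by (auto simp: image_image)
    moreover have "z - y = (+) (- y) z"
      by simp
    ultimately show ?thesis
      unfolding P_def by (simp only: convex_hull_translation) (rule inj_image_mem_iff, simp)
  qed
  have le: "(\<forall>x\<in>P. (z - y) \<bullet> (x - z) \<le> 0) \<longleftrightarrow> (\<forall>i. (z - y) \<bullet> (c i - z) \<le> 0)" for z
  proof
    assume "\<forall>x\<in>P. (z - y) \<bullet> (x - z) \<le> 0"
    then show "\<forall>i. (z - y) \<bullet> (c i - z) \<le> 0"
      by (auto simp: P_def hull_inc)
  next
    assume *: "\<forall>i. (z - y) \<bullet> (c i - z) \<le> 0"
    have "P \<subseteq> {x. (z - y) \<bullet> x \<le> (z - y) \<bullet> z}"
      unfolding P_def by (intro hull_minimal convex_halfspace_le) (use * in \<open>auto simp: inner_diff_right\<close>)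
    then show "\<forall>x\<in>P. (z - y) \<bullet> (x - z) \<le> 0"
      by (auto simp: inner_diff_right)
  qed
  have "normal_base P y z \<longleftrightarrow> z - y \<in> critical (\<lambda>i. c i - y)" for z
  proof -
    have "(z - y) \<bullet> (c i - z) \<le> 0 \<longleftrightarrow> (z - y) \<bullet> (c i - y) \<le> (z - y) \<bullet> (z - y)" for i
      by (simp add: inner_diff_right)
    then show ?thesis
      using y by (simp add: critical_def P normal_base_iff flip: P_def) (simp add: le)
  qed
  then have "bij_betw (\<lambda>z. z - y) {z. normal_base P y z} (critical (\<lambda>i. c i - y))"
    by (intro bij_betw_byWitness[where f' = "\<lambda>z. z + y"]) auto
  then show ?thesis
    unfolding num_normals_eq_card_bases P_def by (rule bij_betw_same_card)
qed

section \<open>Existence of the polar simplex\<close>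

text \<open>\<open>l\<close> collects the barycentric coordinates of \<open>y\<close>, positive
  because \<open>y\<close> is interior. \<open>w i\<close> represents a functional equal to 1 at the
  other vertices, which are independent; the weighted sum fixes its value at
  \<open>v i\<close>.\<close>

lemma dual_simplices_exists:
  fixes c :: "'i::finite \<Rightarrow> 'a::euclidean_space"
  assumes inj: "inj c" and indep: "\<not> affine_dependent (range c)"
    and y: "y \<in> interior (convex hull (range c))"
  shows "\<exists>w l. dual_simplices (\<lambda>i. c i - y) w l"
proof -
  define v where "v = (\<lambda>i. c i - y)"
  obtain u where u: "\<forall>x\<in>range c. 0 < u x" "sum u (range c) = 1" "(\<Sum>x\<in>range c. u x *\<^sub>R x) = y"
    using y unfolding interior_convex_hull_explicit_minimal[OF indep] by (auto split: if_splits)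
  define l where "l = u \<circ> c"
  have l_pos: "l i > 0" for i
    using u(1) by (simp add: l_def)
  have sum_l: "sum l UNIV = 1"
    using u(2) sum.reindex[OF inj, of u] by (simp add: l_def)
  have sum_c: "(\<Sum>i\<in>UNIV. l i *\<^sub>R c i) = y"
    using u(3) sum.reindex[OF inj, of "\<lambda>x. u x *\<^sub>R x"] by (simp add: l_def o_def)
  have sum_v: "(\<Sum>i\<in>UNIV. l i *\<^sub>R v i) = 0"
    by (simp add: v_def scaleR_diff_right sum_subtractf sum_c sum_l flip: scaleR_left.sum)
  have zero: "t i = 0" if t: "sum t UNIV = 0" "(\<Sum>i\<in>UNIV. t i *\<^sub>R c i) = 0" for t :: "'i \<Rightarrow> real" and i
  proof (rule ccontr)
    assume "t i \<noteq> 0"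
    define U where "U = t \<circ> inv c"
    have "sum U (range c) = 0" "(\<Sum>x\<in>range c. U x *\<^sub>R x) = 0" "U (c i) \<noteq> 0"
      using t \<open>t i \<noteq> 0\<close> inj by (simp_all add: U_def sum.reindex[OF inj])
    then have "affine_dependent (range c)"
      by (subst affine_dependent_explicit_finite) auto
    then show False
      using indep by simp
  qed
  have inj_v: "inj v"
    using inj by (auto simp: inj_def v_def)
  have "\<exists>w. \<forall>j. j \<noteq> i \<longrightarrow> w \<bullet> v j = 1" for i
  proof -
    have "independent (v ` (UNIV - {i}))"
    proof
      assume "dependent (v ` (UNIV - {i}))"
      then obtain s k where s: "(\<Sum>x\<in>v ` (UNIV - {i}). s x *\<^sub>R x) = 0" and k: "k \<noteq> i" "s (v k) \<noteq> 0"
        by (auto simp: dependent_finite)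
      define t where "t j = (if j = i then 0 else s (v j))" for j
      have "(\<Sum>x\<in>v ` (UNIV - {i}). s x *\<^sub>R x) = (\<Sum>j\<in>UNIV - {i}. s (v j) *\<^sub>R v j)"
        using inj_v by (intro sum.reindex_cong) (auto intro: inj_on_subset)
      also have "\<dots> = (\<Sum>j\<in>UNIV. t j *\<^sub>R v j)"
        by (intro sum.mono_neutral_cong_left) (auto simp: t_def)
      finally have "(\<Sum>j\<in>UNIV. t j *\<^sub>R c j) = sum t UNIV *\<^sub>R y"
        using s by (simp add: v_def scaleR_diff_right sum_subtractf flip: scaleR_left.sum)
      \<comment> \<open>Subtracting a multiple of \<open>l\<close> makes the coefficients add up to
        0, so affine independence applies. As \<open>t i = 0\<close> and \<open>l i > 0\<close>, the
        multiple is 0.\<close>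
      then have "(\<Sum>j\<in>UNIV. (t j - sum t UNIV * l j) *\<^sub>R c j) = 0"
        by (simp add: scaleR_left_diff_distrib sum_subtractf sum_c flip: scaleR_scaleR scaleR_right.sum)
      moreover have "(\<Sum>j\<in>UNIV. t j - sum t UNIV * l j) = 0"
        by (simp add: sum_subtractf sum_l flip: sum_distrib_left)
      ultimately have *: "t j - sum t UNIV * l j = 0" for j
        using zero[of "\<lambda>j. t j - sum t UNIV * l j" j] by simp
      have "sum t UNIV = 0"
        using *[of i] l_pos[of i] by (simp add: t_def)
      then show False
        using *[of k] k by (simp add: t_def)
    qed
    then obtain f :: "'a \<Rightarrow> real" where f: "linear f" "\<forall>x\<in>v ` (UNIV - {i}). f x = 1"
      using linear_independent_extend[of "v ` (UNIV - {i})" "\<lambda>_. 1"] by blast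
    have "adjoint f 1 \<bullet> x = f x" for x
      using adjoint_works[OF f(1), of x 1] by (simp add: inner_commute)
    then show ?thesis
      using f(2) by (intro exI[of _ "adjoint f 1"]) auto
  qed
  then obtain w where w: "j \<noteq> i \<Longrightarrow> w i \<bullet> v j = 1" for i j
    by metis
  have wv: "l i * (w i \<bullet> v i) = l i - 1" for i
  proof -
    have "0 = (\<Sum>j\<in>UNIV. l j * (w i \<bullet> v j))"
      using arg_cong[OF sum_v, of "inner (w i)"] by (simp add: inner_sum_right)
    also have "\<dots> = l i * (w i \<bullet> v i) + (\<Sum>j\<in>UNIV - {i}. l j * (w i \<bullet> v j))"
      by (simp add: sum.remove[of UNIV i])
    also have "(\<Sum>j\<in>UNIV - {i}. l j * (w i \<bullet> v j)) = (\<Sum>j\<in>UNIV - {i}. l j)"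
      by (intro sum.cong) (auto simp: w)
    also have "\<dots> = 1 - l i"
      using sum_l by (simp add: sum.remove[of UNIV i])
    finally show ?thesis
      by simp
  qed
  have res_v: "l i * (w i \<bullet> v j) = l i - (if i = j then 1 else 0)" for i j
    using wv w by auto
  have "dual_simplices v w l"
  proof
    fix x x' :: 'a
    obtain \<epsilon> where \<epsilon>: "\<epsilon> > 0" "cball y \<epsilon> \<subseteq> convex hull (range c)"
      using y by (auto simp: mem_interior_cball)
    \<comment> \<open>Scaled by \<open>d\<close>, the vector \<open>x\<close> stays in the ball when
      attached to \<open>y\<close>. Thus \<open>x\<close> is a combination of the
      \<open>v i\<close>, and \<open>resolution\<close> need only be checked on these.\<close>
    define d where "d = \<epsilon> / (norm x + 1)"
    have "norm x + 1 > 0"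
      using norm_ge_zero[of x] by linarith
    then have "d > 0" "d * norm x \<le> \<epsilon>"
      using \<epsilon>(1) by (auto simp: d_def field_simps)
    then have "y + d *\<^sub>R x \<in> convex hull (range c)"
      by (intro subsetD[OF \<epsilon>(2)]) (simp add: dist_norm)
    then obtain s where s: "sum s UNIV = 1" "y + d *\<^sub>R x = (\<Sum>i\<in>UNIV. s i *\<^sub>R c i)"
      by (rule hull_range_explicit)
    have dx: "d *\<^sub>R x = (\<Sum>i\<in>UNIV. s i *\<^sub>R v i)"
      using s by (simp add: v_def scaleR_diff_right sum_subtractf algebra_simps flip: scaleR_left.sum)
    have "x = (1 / d) *\<^sub>R (d *\<^sub>R x)"
      using \<open>d > 0\<close> by simp
    then have x: "x = (\<Sum>i\<in>UNIV. (s i / d) *\<^sub>R v i)"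
      unfolding dx by (simp add: scaleR_right.sum)
    have "(\<Sum>i\<in>UNIV. l i * (w i \<bullet> v j) * (v i \<bullet> x')) = - (v j \<bullet> x')" for j
    proof -
      have "(\<Sum>i\<in>UNIV. l i * (w i \<bullet> v j) * (v i \<bullet> x'))
          = (\<Sum>i\<in>UNIV. l i *\<^sub>R v i) \<bullet> x' - (\<Sum>i\<in>UNIV. if i = j then v j \<bullet> x' else 0)"
        unfolding res_v inner_sum_left sum_subtractf[symmetric]
        by (intro sum.cong) (auto simp: algebra_simps)
      then show ?thesis
        by (simp add: sum_v)
    qed
    moreover have "x \<bullet> x' = (\<Sum>j\<in>UNIV. (s j / d) * (v j \<bullet> x'))"
      using arg_cong[OF x, of "\<lambda>p. p \<bullet> x'"] by (simp add: inner_sum_left)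
    moreover have "w i \<bullet> x = (\<Sum>j\<in>UNIV. (s j / d) * (w i \<bullet> v j))" for i
      using arg_cong[OF x, of "inner (w i)"] by (simp add: inner_sum_right)
    then have "(\<Sum>i\<in>UNIV. l i * (w i \<bullet> x) * (v i \<bullet> x'))
        = (\<Sum>j\<in>UNIV. (s j / d) * (\<Sum>i\<in>UNIV. l i * (w i \<bullet> v j) * (v i \<bullet> x')))"
      unfolding sum_distrib_left
      by (subst sum.swap) (simp add: sum_distrib_left sum_distrib_right mult_ac)
    ultimately show "x \<bullet> x' = - (\<Sum>i\<in>UNIV. l i * (w i \<bullet> x) * (v i \<bullet> x'))"
      by (simp add: sum_negf)
    show "w i \<bullet> v i = 1 - 1 / l i" for i
      using wv[of i] l_pos[of i] by (simp add: field_simps)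
  qed (use l_pos w in auto)
  then show ?thesis
    unfolding v_def by blast
qed

lemma num_normals_ge_4:
  assumes "3 simplex P" "y \<in> interior P"
  shows "num_normals P y \<ge> 4"
proof -
  obtain C where C: "\<not> affine_dependent C" "int (card C) = 3 + 1" "P = convex hull C"
    using assms(1) by (auto simp: simplex)
  have "finite C"
    using C(2) by (intro card_ge_0_finite) simp
  moreover have "card (UNIV :: 4 set) = card C"
    using C(2) by simp
  ultimately obtain c :: "4 \<Rightarrow> real^3" where "bij_betw c UNIV C"
    using finite_same_card_bij[of "UNIV :: 4 set" C] by auto
  then have c: "inj c" "range c = C"
    by (auto simp: bij_betw_def)
  obtain w l where "dual_simplices (\<lambda>i. c i - y) w l"
    using dual_simplices_exists[of c y] c C assms(2) by auto
  then interpret dual_tetrahedra "\<lambda>i. c i - y" w l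
    by (simp add: dual_tetrahedra_def dual_tetrahedra_axioms_def)
  show ?thesis
    using num_normals_eq_card_critical[of y c] assms(2) four_critical c C by simp
qed

section \<open>A tetrahedron with exactly four normals\<close>

text \<open>Consecutive vertices have the positive inner products 8, 19 and 3, all other pairs
  negative ones: the acute path configuration of the lower bound.\<close>

definition example_vertex :: "4 \<Rightarrow> real^3" where
  "example_vertex i = (if i = 1 then vector [-2, -1, 0] else if i = 2 then vector [2, -12, -1]
    else if i = 3 then vector [4, -1, 1] else vector [1, 1, 0])"

lemma example_vertex_simps:
  "example_vertex 1 = vector [-2, -1, 0]" "example_vertex 2 = vector [2, -12, -1]"
  "example_vertex 3 = vector [4, -1, 1]" "example_vertex 4 = vector [1, 1, 0]"
  by (simp_all add: example_vertex_def)

lemma inj_example_vertex: "inj example_vertex"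
  unfolding inj_def forall_4 by (simp add: example_vertex_simps vec_eq_iff forall_3)

lemma example_vertex_independent: "\<not> affine_dependent (range example_vertex)"
proof
  assume "affine_dependent (range example_vertex)"
  then obtain U where U: "sum U (range example_vertex) = 0" "\<exists>x\<in>range example_vertex. U x \<noteq> 0"
      "(\<Sum>x\<in>range example_vertex. U x *\<^sub>R x) = 0"
    by (auto simp: affine_dependent_explicit_finite)
  have "U (example_vertex 1) + U (example_vertex 2) + U (example_vertex 3) + U (example_vertex 4) = 0"
    using U(1) by (simp add: sum.reindex[OF inj_example_vertex] sum_4)
  moreover have "(\<Sum>i\<in>UNIV. U (example_vertex i) *\<^sub>R example_vertex i) = 0"
    using U(3) by (simp add: sum.reindex[OF inj_example_vertex])
  then have "- 2 * U (example_vertex 1) + 2 * U (example_vertex 2) + 4 * U (example_vertex 3) + U (example_vertex 4) = 0"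
    "- U (example_vertex 1) - 12 * U (example_vertex 2) - U (example_vertex 3) + U (example_vertex 4) = 0"
    "U (example_vertex 3) - U (example_vertex 2) = 0"
    unfolding sum_4 example_vertex_simps by (simp_all add: vec_eq_iff forall_3 algebra_simps)
  ultimately have "\<forall>i. U (example_vertex i) = 0"
    unfolding forall_4 by linarith
  then show False
    using U(2) by auto
qed

lemma zero_interior_example: "0 \<in> interior (convex hull (range example_vertex))"
proof -
  \<comment> \<open>The barycentric coordinates of the origin, all positive.\<close>
  define l :: "4 \<Rightarrow> real" where
    "l i = (if i = 1 then 19/53 else if i = 4 then 32/53 else 1/53)" for i
  have "card (range example_vertex) = 4"
    by (simp add: card_image inj_example_vertex)
  moreover have "\<forall>x\<in>range example_vertex. 0 < (l \<circ> inv example_vertex) x"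
    by (simp add: l_def)
  moreover have "sum (l \<circ> inv example_vertex) (range example_vertex) = 1"
    by (simp add: sum.reindex[OF inj_example_vertex] inj_example_vertex sum_4 l_def)
  moreover have "(\<Sum>x\<in>range example_vertex. (l \<circ> inv example_vertex) x *\<^sub>R x) = (\<Sum>i\<in>UNIV. l i *\<^sub>R example_vertex i)"
    by (simp add: sum.reindex[OF inj_example_vertex] inj_example_vertex)
  moreover have "(\<Sum>i\<in>UNIV. l i *\<^sub>R example_vertex i) = 0"
    unfolding sum_4 example_vertex_simps by (simp add: l_def vec_eq_iff forall_3)
  ultimately show ?thesis
    unfolding interior_convex_hull_explicit_minimal[OF example_vertex_independent] by auto
qed

text \<open>
  In barycentric coordinates being critical is a linear complementarity problem, so that each of
  the 16 choices of tight constraints is settled by linear arithmetic.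
\<close>

lemma card_critical_example_le: "card (critical example_vertex) \<le> 4"
proof -
  define pt where "pt p q r s = p *\<^sub>R example_vertex 1 + q *\<^sub>R example_vertex 2 + r *\<^sub>R example_vertex 3 + s *\<^sub>R example_vertex 4"
    for p q r s :: real
  \<comment> \<open>In order: the longest vertex, the foot on the edge joining vertices 1 and 4, and
    the feet on the faces opposite vertices 2 and 3.\<close>
  have "critical example_vertex \<subseteq> {pt 0 1 0 0, pt (5/13) 0 0 (8/13), pt (65/157) 0 (12/157) (80/157),
      pt (579/1694) (41/1694) 0 (1074/1694)}"
  proof
    fix z assume z: "z \<in> critical example_vertex"
    then obtain u where u: "\<And>i. u i \<ge> 0" "sum u UNIV = 1" "z = (\<Sum>i\<in>UNIV. u i *\<^sub>R example_vertex i)"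
      using hull_range_explicit[of z example_vertex] by (auto simp: critical_def)
    define t where "t = z \<bullet> z"
    define p q r s where "p = u 1" "q = u 2" "r = u 3" "s = u 4"
    note defs = this
    have zv: "z = pt p q r s"
      by (simp add: u(3) sum_4 pt_def defs)
    have nonneg: "p \<ge> 0" "q \<ge> 0" "r \<ge> 0" "s \<ge> 0" and sum: "p + q + r + s = 1" and "t > 0"
      using u z by (simp_all add: defs sum_4 t_def critical_def)
    have inner: "z \<bullet> example_vertex 1 = 5 * p + 8 * q - 7 * r - 3 * s"
      "z \<bullet> example_vertex 2 = 8 * p + 149 * q + 19 * r - 10 * s"
      "z \<bullet> example_vertex 3 = - 7 * p + 19 * q + 18 * r + 3 * s"
      "z \<bullet> example_vertex 4 = - 3 * p - 10 * q + 3 * r + 2 * s"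
      unfolding zv pt_def example_vertex_simps by (simp_all add: inner_vec_def sum_3 algebra_simps)
    have le: "5 * p + 8 * q - 7 * r - 3 * s \<le> t" "8 * p + 149 * q + 19 * r - 10 * s \<le> t"
      "- 7 * p + 19 * q + 18 * r + 3 * s \<le> t" "- 3 * p - 10 * q + 3 * r + 2 * s \<le> t"
      unfolding inner[symmetric] t_def using z by (auto simp: critical_def)
    have "u i = 0 \<or> z \<bullet> example_vertex i = t" for i
      using critical_weights[OF z u, of i] by (auto simp: t_def)
    from this[of 1] this[of 2] this[of 3] this[of 4]
    have compl: "(p = 0 \<or> 5 * p + 8 * q - 7 * r - 3 * s = t)
      \<and> (q = 0 \<or> 8 * p + 149 * q + 19 * r - 10 * s = t)
      \<and> (r = 0 \<or> - 7 * p + 19 * q + 18 * r + 3 * s = t)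
      \<and> (s = 0 \<or> - 3 * p - 10 * q + 3 * r + 2 * s = t)"
      unfolding inner defs[symmetric] by blast
    have "(p = 0 \<and> q = 1 \<and> r = 0 \<and> s = 0) \<or> (p = 5/13 \<and> q = 0 \<and> r = 0 \<and> s = 8/13)
      \<or> (p = 65/157 \<and> q = 0 \<and> r = 12/157 \<and> s = 80/157)
      \<or> (p = 579/1694 \<and> q = 41/1694 \<and> r = 0 \<and> s = 1074/1694)"
      by (insert compl nonneg sum le \<open>t > 0\<close>, elim conjE disjE;
          ((rule FalseE, linarith)
          | (rule disjI1, (intro conjI; linarith))
          | (rule disjI2, rule disjI1, (intro conjI; linarith))
          | (rule disjI2, rule disjI2, rule disjI1, (intro conjI; linarith))
          | (rule disjI2, rule disjI2, rule disjI2, (intro conjI; linarith))))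
    then show "z \<in> {pt 0 1 0 0, pt (5/13) 0 0 (8/13), pt (65/157) 0 (12/157) (80/157),
        pt (579/1694) (41/1694) 0 (1074/1694)}"
      unfolding zv by blast
  qed
  then have "card (critical example_vertex) \<le> card {pt 0 1 0 0, pt (5/13) 0 0 (8/13),
      pt (65/157) 0 (12/157) (80/157), pt (579/1694) (41/1694) 0 (1074/1694)}"
    by (intro card_mono) auto
  also have "\<dots> \<le> 4"
    by (simp add: card_insert_if)
  finally show ?thesis .
qed

theorem theorem3:
  "(\<forall>(P :: (real^3) set) y. 3 simplex P \<longrightarrow> y \<in> interior P \<longrightarrow> num_normals P y \<ge> 4) \<and>
   (\<exists>(P :: (real^3) set) y. 3 simplex P \<and> y \<in> interior P \<and> num_normals P y = 4)"
proof
  show "\<forall>(P :: (real^3) set) y. 3 simplex P \<longrightarrow> y \<in> interior P \<longrightarrow> num_normals P y \<ge> 4"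
    using num_normals_ge_4 by blast
  have "3 simplex (convex hull (range example_vertex))"
    unfolding simplex using example_vertex_independent
    by (intro exI[of _ "range example_vertex"]) (simp add: card_image inj_example_vertex)
  moreover have "num_normals (convex hull (range example_vertex)) 0 \<le> 4"
    using card_critical_example_le by (simp add: num_normals_eq_card_critical[OF zero_interior_example])
  ultimately show "\<exists>(P :: (real^3) set) y. 3 simplex P \<and> y \<in> interior P \<and> num_normals P y = 4"
    using zero_interior_example num_normals_ge_4 by (meson order_antisym)
qed

end
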